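(* Let $G$ be a graph of order $n$ with $\delta(G)\geq\frac56n$ whose edges have been coloured with three colours. Then $G$ has a monochromatic component of order at least $\frac n2$.
   Context: $\delta(G)$ denotes the minimum degree of $G$. For an edge-colouring of $G$, a monochromatic component of a given colour is a connected component of the graph formed by the edges of that colour (on the vertices incident with such edges); its order is its number of vertices. *)

theory Defs
  imports Complex_Main
begin

definition simple_graph :: "'a set \<Rightarrow> 'a set set \<Rightarrow> bool" where
  "simple_graph V E \<longleftrightarrow> finite V \<and> V \<noteq> {} \<and> (\<forall>e\<in>E. e \<subseteq> V \<and> card e = 2)"

definition degree :: "'a set set \<Rightarrow> 'a \<Rightarrow> nat" where
  "degree E v = card {e \<in> E. v \<in> e}"

definition min_degree :: "'a set \<Rightarrow> 'a set set \<Rightarrow> nat" where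
  "min_degree V E = Min (degree E ` V)"

definition adj_rel :: "'a set set \<Rightarrow> ('a \<times> 'a) set" where
  "adj_rel E = {(u, v). {u, v} \<in> E}"

text \<open>Connected components are represented by their vertex sets, the classes of the relation
  ``joined by a walk''.\<close>

definition connected_components :: "'a set \<Rightarrow> 'a set set \<Rightarrow> 'a set set" where
  "connected_components V E = V // {(u, v). u \<in> V \<and> v \<in> V \<and> (u, v) \<in> (adj_rel E)\<^sup>*}"

definition colour_class :: "'a set set \<Rightarrow> ('a set \<Rightarrow> 'c) \<Rightarrow> 'c \<Rightarrow> 'a set set" where
  "colour_class E c i = {e \<in> E. c e = i}"

text \<open>The graph formed by the edges of colour \<open>i\<close> has only the vertices incident with such an
  edge, so an isolated vertex is not a monochromatic component.\<close>

definition monochromatic_components ::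
    "'a set set \<Rightarrow> ('a set \<Rightarrow> 'c) \<Rightarrow> 'c \<Rightarrow> 'a set set" where
  "monochromatic_components E c i =
     connected_components (\<Union> (colour_class E c i)) (colour_class E c i)"

end

theory Submission
  imports Defs
begin

text \<open>Suppose that every monochromatic component has fewer than \<open>n/2\<close> vertices. Call two vertices
  far apart if they lie in different components of all three colours; far vertices are not adjacent,
  so each vertex is far from fewer than \<open>n/6\<close> others. Three vertices of a red component \<open>R\<close> whose blue
  and green components are all different have no common neighbour outside \<open>R\<close>, which is impossible
  since \<open>|V - R| > n/2\<close>. By the Koenig theorem on matchings \<open>R\<close> is covered by two blue or green components.
  Looking at the vertices outside the cover, one first finds that \<open>R\<close> has fewer than \<open>n/3\<close> vertices.
  Hence, for all colours alike, more than \<open>n/3\<close> vertices lie outside the cover, and then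
  \<open>R\<close> is contained in a single component of another colour, which is impossible.\<close>

section \<open>Covering a family of pairs by two lines\<close>

text \<open>Read each point as an edge joining its \<open>b\<close>-value to its
  \<open>g\<close>-value in a bipartite graph: this is the Koenig theorem for matching number at
  most two.\<close>

lemma cover_by_two_lines:
  assumes "\<And>x y z. \<lbrakk>x \<in> X; y \<in> X; z \<in> X; b x \<noteq> b y; b x \<noteq> b z; b y \<noteq> b z;
      g x \<noteq> g y; g x \<noteq> g z; g y \<noteq> g z\<rbrakk> \<Longrightarrow> False"
  obtains (blue) \<beta>1 \<beta>2 where "\<forall>x\<in>X. b x = \<beta>1 \<or> b x = \<beta>2"
  | (green) \<gamma>1 \<gamma>2 where "\<forall>x\<in>X. g x = \<gamma>1 \<or> g x = \<gamma>2"
  | (mixed) \<beta> \<gamma> where "\<forall>x\<in>X. b x = \<beta> \<or> g x = \<gamma>"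
proof (cases "\<exists>x\<in>X. \<exists>y\<in>X. b x \<noteq> b y \<and> g x \<noteq> g y")
  case True
  then obtain x y where xy: "x \<in> X" "y \<in> X" "b x \<noteq> b y" "g x \<noteq> g y" by blast
  show thesis
  proof (rule ccontr)
    assume no: "\<not> thesis"
    \<comment> \<open>Each of the four witnesses escapes one of the covers formed by the lines
      through \<open>x\<close> and \<open>y\<close>.\<close>
    obtain p where p: "p \<in> X" "b p \<noteq> b x" "b p \<noteq> b y" using blue no by blast
    obtain q where q: "q \<in> X" "g q \<noteq> g x" "g q \<noteq> g y" using green no by blast
    obtain s where s: "s \<in> X" "b s \<noteq> b x" "g s \<noteq> g y" using mixed no by blast
    obtain t where t: "t \<in> X" "b t \<noteq> b y" "g t \<noteq> g x" using mixed no by blast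
    have P: "g p = g x \<or> g p = g y" using assms[of x y p] xy p by metis
    have Q: "b q = b x \<or> b q = b y" using assms[of x y q] xy q by metis
    consider "g p = g x" "b q = b x" | "g p = g y" "b q = b y"
      | "g p = g x" "b q = b y" | "g p = g y" "b q = b x"
      using P Q by blast
    then show False
    proof cases
      case 1
      then show False using assms[of p q y] xy p q by metis
    next
      case 2
      then show False using assms[of p q x] xy p q by metis
    next
      case 3
      then show False
        using assms[of p q t] assms[of t x y] assms[of t p y] assms[of t x q] xy p q t by metis
    next
      case 4
      then show False
        using assms[of p q s] assms[of s x y] assms[of s p x] assms[of s y q] xy p q s by metis
    qed
  qed
next
  case False
  \<comment> \<open>Any two points share a line, so the two lines through any one point cover
    \<open>X\<close>.\<close>
  then show thesis using mixed by (cases "X = {}") (auto, metis)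
qed

section \<open>Three partitions with few far vertices\<close>

text \<open>The labels stand for the components in each colour; the degree condition enters only
  through \<open>far_less\<close>.\<close>

locale three_partitions =
  fixes V :: "'a set" and r b g :: "'a \<Rightarrow> 'b"
  assumes finite_V: "finite V"
    and r_class: "2 * card {v \<in> V. r v = l} < card V"
    and b_class: "2 * card {v \<in> V. b v = l} < card V"
    and g_class: "2 * card {v \<in> V. g v = l} < card V"
    and far_less: "v \<in> V \<Longrightarrow> 6 * card {u \<in> V. r u \<noteq> r v \<and> b u \<noteq> b v \<and> g u \<noteq> g v} < card V"
begin

text \<open>Together with \<open>swap_bg\<close> this generates all permutations of the colours, so
  later lemmas can be reused with the colours in other roles.\<close>

lemma swap_rb: "three_partitions V b r g"
  using finite_V r_class b_class g_class far_less by unfold_locales (auto simp: conj_ac)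

lemma swap_bg: "three_partitions V r g b"
  using finite_V r_class b_class g_class far_less by unfold_locales (auto simp: conj_ac)

definition far :: "'a \<Rightarrow> 'a set" where
  "far v = {u \<in> V. r u \<noteq> r v \<and> b u \<noteq> b v \<and> g u \<noteq> g v}"

lemma finite_far: "finite (far v)"
  using finite_V by (simp add: far_def)

lemma card_far: "v \<in> V \<Longrightarrow> 6 * card (far v) < card V"
  using far_less by (simp add: far_def)

lemma card_cover1:
  assumes "x \<in> V" "S \<subseteq> far x"
  shows "6 * card S < card V"
  using card_mono[OF finite_far assms(2)] card_far[OF assms(1)] by linarith

lemma card_cover2:
  assumes "x \<in> V" "y \<in> V" "S \<subseteq> far x \<union> far y"
  shows "3 * card S < card V"
proof -
  have "card S \<le> card (far x \<union> far y)" by (intro card_mono) (auto simp: finite_far assms)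
  also have "\<dots> \<le> card (far x) + card (far y)" by (rule card_Un_le)
  finally show ?thesis using card_far[OF assms(1)] card_far[OF assms(2)] by linarith
qed

lemma card_cover3:
  assumes "x \<in> V" "y \<in> V" "z \<in> V" "S \<subseteq> far x \<union> far y \<union> far z"
  shows "2 * card S < card V"
proof -
  have "card S \<le> card (far x \<union> far y \<union> far z)" by (intro card_mono) (auto simp: finite_far assms)
  also have "\<dots> \<le> card (far x) + card (far y) + card (far z)"
    using card_Un_le[of "far x \<union> far y" "far z"] card_Un_le[of "far x" "far y"] by linarith
  finally show ?thesis using card_far[OF assms(1)] card_far[OF assms(2)] card_far[OF assms(3)]
    by linarith
qed

lemma card_outside: "card {v \<in> V. P v} + card {v \<in> V. \<not> P v} = card V"
proof -
  have "card ({v \<in> V. P v} \<union> {v \<in> V. \<not> P v}) = card {v \<in> V. P v} + card {v \<in> V. \<not> P v}"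
    using finite_V by (intro card_Un_disjoint) auto
  moreover have "{v \<in> V. P v} \<union> {v \<in> V. \<not> P v} = V" by auto
  ultimately show ?thesis by simp
qed

lemma card_or_le: "card {v \<in> V. P v \<or> Q v} \<le> card {v \<in> V. P v} + card {v \<in> V. Q v}"
proof -
  have "{v \<in> V. P v \<or> Q v} = {v \<in> V. P v} \<union> {v \<in> V. Q v}" by auto
  then show ?thesis by (simp add: card_Un_le)
qed

text \<open>If this failed, all edges between \<open>P\<close> and \<open>Q\<close> below would be red and nearly all of them
  would be present, so \<open>P \<union> Q\<close> would be a red class that is too large.\<close>

lemma card_outside_blue_green:
  "card V \<le> 6 * card {v \<in> V. b v \<noteq> \<beta> \<and> g v \<noteq> \<gamma>}"
proof (rule ccontr)
  assume "\<not> ?thesis"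
  then have Z: "6 * card {v \<in> V. b v \<noteq> \<beta> \<and> g v \<noteq> \<gamma>} < card V" by simp
  define P where "P = {v \<in> V. b v = \<beta> \<and> g v \<noteq> \<gamma>}"
  define Q where "Q = {v \<in> V. b v \<noteq> \<beta> \<and> g v = \<gamma>}"
  have PZ: "{v \<in> V. g v \<noteq> \<gamma>} = {v \<in> V. b v = \<beta> \<and> g v \<noteq> \<gamma> \<or> b v \<noteq> \<beta> \<and> g v \<noteq> \<gamma>}" by auto
  \<comment> \<open>More than half of \<open>V\<close> lies outside a class; dropping fewer than a
    sixth leaves more than a third, too many for two far sets to cover.\<close>
  have P: "3 * card P > card V"
    using card_or_le[of "\<lambda>v. b v = \<beta> \<and> g v \<noteq> \<gamma>" "\<lambda>v. b v \<noteq> \<beta> \<and> g v \<noteq> \<gamma>"]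
      card_outside[of "\<lambda>v. g v = \<gamma>"] g_class[of \<gamma>] Z unfolding P_def PZ by linarith
  have QZ: "{v \<in> V. b v \<noteq> \<beta>} = {v \<in> V. b v \<noteq> \<beta> \<and> g v = \<gamma> \<or> b v \<noteq> \<beta> \<and> g v \<noteq> \<gamma>}" by auto
  have Q: "3 * card Q > card V"
    using card_or_le[of "\<lambda>v. b v \<noteq> \<beta> \<and> g v = \<gamma>" "\<lambda>v. b v \<noteq> \<beta> \<and> g v \<noteq> \<gamma>"]
      card_outside[of "\<lambda>v. b v = \<beta>"] b_class[of \<beta>] Z unfolding Q_def QZ by linarith
  \<comment> \<open>Vertices of \<open>P\<close> and \<open>Q\<close> differ in blue and green, so
    only a common red class keeps them from being far.\<close>
  have PQ: "\<exists>q\<in>Q. r q = r x \<and> r q = r y" if "x \<in> P" "y \<in> P" for x y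
  proof -
    have "\<not> Q \<subseteq> far x \<union> far y" using card_cover2[of x y Q] Q that by (auto simp: P_def)
    then show ?thesis using that by (auto simp: P_def Q_def far_def)
  qed
  have QP: "\<exists>p\<in>P. r p = r x \<and> r p = r y" if "x \<in> Q" "y \<in> Q" for x y
  proof -
    have "\<not> P \<subseteq> far x \<union> far y" using card_cover2[of x y P] P that by (auto simp: Q_def)
    then show ?thesis using that by (auto simp: P_def Q_def far_def)
  qed
  have "P \<noteq> {}" using P by auto
  then obtain p where p: "p \<in> P" by blast
  then obtain q where q: "q \<in> Q" "r q = r p" using PQ by blast
  have "P \<union> Q \<subseteq> {v \<in> V. r v = r p}"
    using PQ[OF p] QP[OF q(1)] q(2) by (fastforce simp: P_def Q_def)
  then have "card (P \<union> Q) \<le> card {v \<in> V. r v = r p}"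
    using finite_V by (intro card_mono) auto
  moreover have "card (P \<union> Q) = card P + card Q"
    using finite_V by (intro card_Un_disjoint) (auto simp: P_def Q_def)
  ultimately show False using P Q r_class[of "r p"] by linarith
qed

text \<open>If the red class of \<open>x\<close> lay inside its blue class, every vertex outside the
  blue and green classes of \<open>x\<close> would be far from \<open>x\<close>; there are too many
  of these.\<close>

lemma red_not_in_blue:
  assumes "x \<in> V"
  obtains y where "y \<in> V" "r y = r x" "b y \<noteq> b x"
proof (rule ccontr)
  assume "\<not> thesis"
  then have "{v \<in> V. b v \<noteq> b x \<and> g v \<noteq> g x} \<subseteq> far x"
    using that by (auto simp: far_def)
  then have "6 * card {v \<in> V. b v \<noteq> b x \<and> g v \<noteq> g x} < card V"
    by (rule card_cover1[OF assms])
  then show False using card_outside_blue_green[of "b x" "g x"] by linarith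
qed

section \<open>Covering a red class by two blue or green classes\<close>

text \<open>A vertex outside the red class shares a blue class with at most one of the three and a
  green class with at most one, so it is far from some of them.\<close>

lemma no_three_independent:
  assumes "x \<in> V" "y \<in> V" "z \<in> V" "r y = r x" "r z = r x"
    and "b x \<noteq> b y" "b x \<noteq> b z" "b y \<noteq> b z" "g x \<noteq> g y" "g x \<noteq> g z" "g y \<noteq> g z"
  shows False
proof -
  have "{v \<in> V. r v \<noteq> r x} \<subseteq> far x \<union> far y \<union> far z"
    using assms by (auto simp: far_def)
  then have "2 * card {v \<in> V. r v \<noteq> r x} < card V"
    by (rule card_cover3[OF assms(1-3)])
  then show False
    using card_outside[of "\<lambda>v. r v = r x"] r_class[of "r x"] by linarith
qed

lemma red_class_cover_cases:
  obtains (blue) \<beta>1 \<beta>2 where "\<forall>x\<in>V. r x = l \<longrightarrow> b x = \<beta>1 \<or> b x = \<beta>2"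
  | (green) \<gamma>1 \<gamma>2 where "\<forall>x\<in>V. r x = l \<longrightarrow> g x = \<gamma>1 \<or> g x = \<gamma>2"
  | (mixed) \<beta> \<gamma> where "\<forall>x\<in>V. r x = l \<longrightarrow> b x = \<beta> \<or> g x = \<gamma>"
proof (rule cover_by_two_lines[of "{x \<in> V. r x = l}" b g])
  show False if "x \<in> {x \<in> V. r x = l}" "y \<in> {x \<in> V. r x = l}" "z \<in> {x \<in> V. r x = l}"
    "b x \<noteq> b y" "b x \<noteq> b z" "b y \<noteq> b z" "g x \<noteq> g y" "g x \<noteq> g z" "g y \<noteq> g z" for x y z
    using no_three_independent[of x y z] that by auto
  show thesis if "\<forall>x\<in>{x \<in> V. r x = l}. b x = \<beta>1 \<or> b x = \<beta>2" for \<beta>1 \<beta>2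
    using blue[of \<beta>1 \<beta>2] that by simp
  show thesis if "\<forall>x\<in>{x \<in> V. r x = l}. g x = \<gamma>1 \<or> g x = \<gamma>2" for \<gamma>1 \<gamma>2
    using green[of \<gamma>1 \<gamma>2] that by simp
  show thesis if "\<forall>x\<in>{x \<in> V. r x = l}. b x = \<beta> \<or> g x = \<gamma>" for \<beta> \<gamma>
    using mixed[of \<beta> \<gamma>] that by simp
qed

section \<open>Every class has fewer than a third of the vertices\<close>

text \<open>Two blue classes miss some \<open>w\<close>, whose blue class meets another green class
  in some \<open>w'\<close>. A vertex of the red class agrees in green with at most one of them and
  is far from the other.\<close>

lemma red_class_third_if_blue_cover:
  assumes "\<forall>x\<in>V. r x = l \<longrightarrow> b x = \<beta>1 \<or> b x = \<beta>2"
  shows "3 * card {x \<in> V. r x = l} < card V"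
proof -
  have "card {x \<in> V. b x = \<beta>1 \<or> b x = \<beta>2} < card V"
    using card_or_le[of "\<lambda>x. b x = \<beta>1" "\<lambda>x. b x = \<beta>2"] b_class[of \<beta>1] b_class[of \<beta>2] by linarith
  then have "{x \<in> V. b x = \<beta>1 \<or> b x = \<beta>2} \<noteq> V" by auto
  then obtain w where w: "w \<in> V" "b w \<noteq> \<beta>1" "b w \<noteq> \<beta>2" by blast
  interpret brg: three_partitions V b r g by (rule swap_rb)
  interpret bgr: three_partitions V b g r by (rule brg.swap_bg)
  obtain w' where w': "w' \<in> V" "b w' = b w" "g w' \<noteq> g w"
    using bgr.red_not_in_blue[OF w(1)] .
  have "{x \<in> V. r x = l} \<subseteq> far w \<union> far w'"
    using w w' assms by (auto simp: far_def)
  then show ?thesis by (rule card_cover2[OF w(1) w'(1)])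
qed

lemma red_class_third_if_green_cover:
  assumes "\<forall>x\<in>V. r x = l \<longrightarrow> g x = \<gamma>1 \<or> g x = \<gamma>2"
  shows "3 * card {x \<in> V. r x = l} < card V"
  by (rule three_partitions.red_class_third_if_blue_cover[OF swap_bg assms])

lemma red_class_third: "3 * card {x \<in> V. r x = l} < card V"
proof (cases rule: red_class_cover_cases[of l])
  case (mixed \<beta> \<gamma>)
  define Z where "Z = {v \<in> V. b v \<noteq> \<beta> \<and> g v \<noteq> \<gamma>}"
  have Z: "\<exists>z\<in>Z. z \<notin> far x" if "x \<in> V" for x
    using card_cover1[OF that, of Z] card_outside_blue_green[of \<beta> \<gamma>] unfolding Z_def by fastforce
  \<comment> \<open>By \<open>mixed\<close>, no vertex of \<open>Z\<close> is in red class
    \<open>l\<close>; so a vertex of \<open>Z\<close> not far from \<open>x\<close> can share only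
    the green class.\<close>
  have zg: "\<exists>z\<in>Z. g z = g x" if "x \<in> V" "r x = l" "b x = \<beta>" for x
    using Z[OF that(1)] mixed that by (fastforce simp: Z_def far_def)
  have zb: "\<exists>z\<in>Z. b z = b x" if "x \<in> V" "r x = l" "g x = \<gamma>" for x
    using Z[OF that(1)] mixed that by (fastforce simp: Z_def far_def)
  have disj: "b x \<noteq> \<beta> \<or> g x \<noteq> \<gamma>" if "x \<in> V" "r x = l" for x
    using zg[OF that] that by (auto simp: Z_def)
  show ?thesis
  proof (cases "\<exists>w\<in>Z. \<exists>z\<in>Z. b w \<noteq> b z \<and> g w \<noteq> g z")
    case True
    then obtain w z where wz: "w \<in> Z" "z \<in> Z" "b w \<noteq> b z" "g w \<noteq> g z" by blast
    \<comment> \<open>Both \<open>w\<close> and \<open>z\<close> avoid \<beta> and \<gamma>, and in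
      the remaining colour \<open>x\<close> agrees with at most one of them.\<close>
    have "{x \<in> V. r x = l} \<subseteq> far w \<union> far z"
      using wz mixed disj by (fastforce simp: far_def Z_def)
    then show ?thesis using card_cover2[of w z] wz by (auto simp: Z_def)
  next
    case False
    \<comment> \<open>Pairwise agreement puts \<open>Z\<close> inside one blue or one green class;
      \<open>zb\<close> or \<open>zg\<close> then turns the mixed cover into a cover in one
      colour.\<close>
    then consider \<beta>' where "\<forall>z\<in>Z. b z = \<beta>'" | \<gamma>' where "\<forall>z\<in>Z. g z = \<gamma>'"
      by metis
    then show ?thesis
    proof cases
      case 1
      then show ?thesis
        using red_class_third_if_blue_cover[of l \<beta> \<beta>'] mixed zb by metis
    next
      case 2
      then show ?thesis
        using red_class_third_if_green_cover[of l \<gamma> \<gamma>'] mixed zg by metis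
    qed
  qed
qed (use red_class_third_if_blue_cover red_class_third_if_green_cover in blast)+

section \<open>Excluding every cover\<close>

text \<open>By \<open>red_class_third\<close>, more than a third of \<open>V\<close> lies outside
  the two blue classes. All of it would be far from one of two vertices of the red class with
  different green labels.\<close>

lemma no_blue_cover:
  assumes "x \<in> V" and cover: "\<forall>y\<in>V. r y = r x \<longrightarrow> b y = \<beta>1 \<or> b y = \<beta>2"
  shows False
proof -
  interpret rgb: three_partitions V r g b by (rule swap_bg)
  interpret brg: three_partitions V b r g by (rule swap_rb)
  obtain y where y: "y \<in> V" "r y = r x" "g y \<noteq> g x"
    using rgb.red_not_in_blue[OF assms(1)] .
  have "{v \<in> V. \<not> (b v = \<beta>1 \<or> b v = \<beta>2)} \<subseteq> far x \<union> far y"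
    using y assms by (auto simp: far_def)
  then have "3 * card {v \<in> V. \<not> (b v = \<beta>1 \<or> b v = \<beta>2)} < card V"
    by (rule card_cover2[OF assms(1) y(1)])
  then show False
    using card_or_le[of "\<lambda>v. b v = \<beta>1" "\<lambda>v. b v = \<beta>2"] brg.red_class_third[of \<beta>1]
      brg.red_class_third[of \<beta>2] card_outside[of "\<lambda>v. b v = \<beta>1 \<or> b v = \<beta>2"] by linarith
qed

lemma no_green_cover:
  assumes "x \<in> V" "\<forall>y\<in>V. r y = r x \<longrightarrow> g y = \<gamma>1 \<or> g y = \<gamma>2"
  shows False
  by (rule three_partitions.no_blue_cover[OF swap_bg assms])

text \<open>The same count shows that the vertices of the red class outside \<gamma> agree in green,
  which leaves a cover by two green classes.\<close>

lemma no_mixed_cover: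
  assumes "x \<in> V" and cover: "\<forall>y\<in>V. r y = r x \<longrightarrow> b y = \<beta> \<or> g y = \<gamma>"
  shows False
proof -
  interpret brg: three_partitions V b r g by (rule swap_rb)
  interpret rgb: three_partitions V r g b by (rule swap_bg)
  interpret grb: three_partitions V g r b by (rule rgb.swap_rb)
  have "g y = g z" if yz: "y \<in> V" "r y = r x" "g y \<noteq> \<gamma>" "z \<in> V" "r z = r x" "g z \<noteq> \<gamma>" for y z
  proof (rule ccontr)
    assume "g y \<noteq> g z"
    then have "{v \<in> V. \<not> (b v = \<beta> \<or> g v = \<gamma>)} \<subseteq> far y \<union> far z"
      using yz cover by (auto simp: far_def)
    then have "3 * card {v \<in> V. \<not> (b v = \<beta> \<or> g v = \<gamma>)} < card V"
      by (rule card_cover2[OF yz(1,4)])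
    then show False
      using card_or_le[of "\<lambda>v. b v = \<beta>" "\<lambda>v. g v = \<gamma>"] brg.red_class_third[of \<beta>]
        grb.red_class_third[of \<gamma>] card_outside[of "\<lambda>v. b v = \<beta> \<or> g v = \<gamma>"] by linarith
  qed
  then have "\<exists>\<gamma>'. \<forall>y\<in>V. r y = r x \<longrightarrow> g y = \<gamma> \<or> g y = \<gamma>'" by metis
  then show False using no_green_cover[OF assms(1)] by blast
qed

lemma contradiction: False
proof -
  have "card V \<noteq> 0" using r_class[of undefined] by linarith
  then have "V \<noteq> {}" by force
  then obtain x where x: "x \<in> V" by blast
  show False
    by (rule red_class_cover_cases[of "r x"])
      (fact no_blue_cover[OF x] no_green_cover[OF x] no_mixed_cover[OF x])+
qed

end

section \<open>From the coloured graph to the partitions\<close>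

text \<open>All of \<open>V\<close> is kept, unlike in \<open>monochromatic_components\<close>, so
  that a vertex without edges of the colour also gets a label, a singleton.\<close>

definition reachable :: "'a set \<Rightarrow> 'a set set \<Rightarrow> 'a \<Rightarrow> 'a set" where
  "reachable V E v = {u \<in> V. (v, u) \<in> (adj_rel E)\<^sup>*}"

lemma sym_adj_rel_rtrancl: "sym ((adj_rel E)\<^sup>*)"
  by (intro sym_rtrancl) (auto simp: sym_def adj_rel_def insert_commute)

lemma reachable_eq_iff:
  assumes "u \<in> V" "v \<in> V"
  shows "reachable V E u = reachable V E v \<longleftrightarrow> (v, u) \<in> (adj_rel E)\<^sup>*"
proof
  assume "reachable V E u = reachable V E v"
  moreover have "u \<in> reachable V E u" using assms by (simp add: reachable_def)
  ultimately show "(v, u) \<in> (adj_rel E)\<^sup>*" by (simp add: reachable_def)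
next
  assume "(v, u) \<in> (adj_rel E)\<^sup>*"
  moreover from this have "(u, v) \<in> (adj_rel E)\<^sup>*" by (rule symD[OF sym_adj_rel_rtrancl])
  ultimately show "reachable V E u = reachable V E v"
    by (auto simp: reachable_def intro: rtrancl_trans)
qed

text \<open>Since the label of a vertex is its own component, bounds on components become bounds on
  label classes.\<close>

lemma reachable_class:
  assumes "v \<in> V"
  shows "{u \<in> V. reachable V E u = reachable V E v} = reachable V E v"
proof -
  have "{u \<in> V. reachable V E u = reachable V E v} = {u \<in> V. (v, u) \<in> (adj_rel E)\<^sup>*}"
    using reachable_eq_iff[OF _ assms] by blast
  then show ?thesis by (simp only: reachable_def)
qed

lemma in_Union_if_adj: "(u, v) \<in> adj_rel E \<Longrightarrow> u \<in> \<Union>E \<and> v \<in> \<Union>E"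
  by (auto simp: adj_rel_def)

lemma reachable_isolated:
  assumes "v \<in> V" "v \<notin> \<Union>E"
  shows "reachable V E v = {v}"
proof -
  have "u = v" if "(v, u) \<in> (adj_rel E)\<^sup>*" for u
    using that assms(2) by (cases rule: converse_rtranclE) (use in_Union_if_adj in fast)+
  then show ?thesis using assms(1) by (auto simp: reachable_def)
qed

lemma reachable_in_components:
  assumes "\<Union>E \<subseteq> V" "v \<in> \<Union>E"
  shows "reachable V E v \<in> connected_components (\<Union>E) E"
proof -
  have "u \<in> \<Union>E" if "(v, u) \<in> (adj_rel E)\<^sup>*" for u
    using that assms(2) by (cases rule: rtranclE) (use in_Union_if_adj in fast)+
  then have "reachable V E v =
      {(u, v). u \<in> \<Union>E \<and> v \<in> \<Union>E \<and> (u, v) \<in> (adj_rel E)\<^sup>*} `` {v}"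
    using assms by (auto simp: reachable_def)
  then show ?thesis
    unfolding connected_components_def by (simp only: quotientI[OF assms(2)])
qed

lemma degree_le_card_neighbours:
  assumes "simple_graph V E" "v \<in> V"
  shows "degree E v \<le> card {u \<in> V. u \<noteq> v \<and> {v, u} \<in> E}"
proof -
  have "{e \<in> E. v \<in> e} \<subseteq> (\<lambda>u. {v, u}) ` {u \<in> V. u \<noteq> v \<and> {v, u} \<in> E}"
  proof
    fix e assume e: "e \<in> {e \<in> E. v \<in> e}"
    then have "e \<subseteq> V" "card e = 2" using assms by (auto simp: simple_graph_def)
    then obtain u where "e = {v, u}" "u \<noteq> v" using e by (auto simp: card_2_iff)
    then show "e \<in> (\<lambda>u. {v, u}) ` {u \<in> V. u \<noteq> v \<and> {v, u} \<in> E}"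
      using e \<open>e \<subseteq> V\<close> by auto
  qed
  moreover have "finite {u \<in> V. u \<noteq> v \<and> {v, u} \<in> E}"
    using assms by (simp add: simple_graph_def)
  ultimately show ?thesis unfolding degree_def by (rule surj_card_le[rotated])
qed

theorem theorem1p7:
  fixes V :: "'a set" and E :: "'a set set" and c :: "'a set \<Rightarrow> nat" and n :: nat
  assumes "simple_graph V E"
    and "card V = n"
    and "real (min_degree V E) \<ge> 5 / 6 * real n"
    and "\<And>e. e \<in> E \<Longrightarrow> c e \<in> {1, 2, 3}"
  shows "\<exists>i \<in> {1, 2, 3}. \<exists>K \<in> monochromatic_components E c i. real (card K) \<ge> real n / 2"
proof (rule ccontr)
  assume "\<not> ?thesis"
  then have small: "2 * card K < n"
    if "i \<in> {1, 2, 3}" "K \<in> monochromatic_components E c i" for i K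
    using that by (fastforce simp: not_le)
  have fin: "finite V" and ne: "V \<noteq> {}" using assms(1) by (auto simp: simple_graph_def)
  have deg: "5 * n \<le> 6 * degree E v" if "v \<in> V" for v
  proof -
    have "min_degree V E \<le> degree E v"
      unfolding min_degree_def using fin that by simp
    then show ?thesis using assms(3) by linarith
  qed
  define N where "N = (\<lambda>v. {u \<in> V. u \<noteq> v \<and> {v, u} \<in> E})"
  have N: "5 * n \<le> 6 * card (N v)" if "v \<in> V" for v
    using deg[OF that] degree_le_card_neighbours[OF assms(1) that] unfolding N_def by linarith
  have Nn: "card (insert v (N v)) = Suc (card (N v))" for v
    using fin by (subst card_insert_disjoint) (auto simp: N_def)
  have Nle: "Suc (card (N v)) \<le> n" if "v \<in> V" for v
    using card_mono[OF fin, of "insert v (N v)"] that Nn[of v] assms(2) by (auto simp: N_def)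
  obtain v0 where "v0 \<in> V" using ne by blast
  \<comment> \<open>From \<open>5n \<le> 6(n - 1)\<close>; this makes empty and singleton classes
    smaller than \<open>n/2\<close>.\<close>
  then have n6: "6 \<le> n" using N[of v0] Nle[of v0] by linarith
  define comp where "comp = (\<lambda>i. reachable V (colour_class E c i))"
  have comp_class: "2 * card {v \<in> V. comp i v = l} < card V" if i: "i \<in> {1, 2, 3}" for i l
  proof (cases "\<exists>v\<in>V. comp i v = l")
    case True
    then obtain v where v: "v \<in> V" "comp i v = l" by blast
    then have eq: "{v \<in> V. comp i v = l} = comp i v"
      using reachable_class[OF v(1), of "colour_class E c i"] by (simp add: comp_def)
    have sub: "\<Union> (colour_class E c i) \<subseteq> V"
      using assms(1) by (auto simp: simple_graph_def colour_class_def)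
    show ?thesis
    proof (cases "v \<in> \<Union> (colour_class E c i)")
      case True
      then have "comp i v \<in> monochromatic_components E c i"
        unfolding comp_def monochromatic_components_def
        using reachable_in_components[OF sub] by blast
      then show ?thesis using small[OF i] eq assms(2) by simp
    next
      case False
      then have "comp i v = {v}"
        unfolding comp_def by (rule reachable_isolated[OF v(1)])
      then show ?thesis using eq n6 assms(2) by simp
    qed
  next
    case False
    then have "{v \<in> V. comp i v = l} = {}" by blast
    then show ?thesis using n6 assms(2) by (simp only: card.empty)
  qed
  have "three_partitions V (comp 1) (comp 2) (comp 3)"
  proof
    fix v assume v: "v \<in> V"
    let ?F = "{u \<in> V. comp 1 u \<noteq> comp 1 v \<and> comp 2 u \<noteq> comp 2 v \<and> comp 3 u \<noteq> comp 3 v}"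
    have "u \<notin> ?F" if u: "u \<in> N v" for u
    proof -
      have e: "{v, u} \<in> E" "u \<in> V" using u by (auto simp: N_def)
      then have "(v, u) \<in> adj_rel (colour_class E c (c {v, u}))"
        by (simp add: adj_rel_def colour_class_def)
      then have "comp (c {v, u}) u = comp (c {v, u}) v"
        unfolding comp_def using reachable_eq_iff[OF e(2) v] by blast
      then show ?thesis using assms(4)[OF e(1)] by auto
    qed
    \<comment> \<open>Excluding \<open>v\<close> itself as well makes the bound by
      \<open>n/6\<close> strict.\<close>
    then have "?F \<subseteq> V - insert v (N v)" by blast
    then have "card ?F \<le> card (V - insert v (N v))" using fin by (intro card_mono) auto
    also have "\<dots> = n - Suc (card (N v))"
      using fin v Nn[of v] assms(2) by (subst card_Diff_subset) (auto simp: N_def)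
    finally show "6 * card ?F < card V" using N[OF v] Nle[OF v] assms(2) by linarith
  qed (use fin comp_class in auto)
  then show False by (rule three_partitions.contradiction)
qed

end
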